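(* Let $\delta\ge1$ be an integer and $n\ge0$. The clustering coefficient $C(\mathcal{W}_n)$ of the graph $\mathcal{W}_n$ is $$C(\mathcal{W}_n)=\frac{\delta+3}{6(\delta+4)^n+3\delta+3}\left(\sum_{i=1}^{n}\frac{6(\delta+4)^{i-1}(\delta+1)}{2(\delta+2)^{n-i}+\delta-1}+\frac{3\delta+3}{2(\delta+2)^{n}+\delta-1}\right).$$
   Context: The clustering coefficient of a vertex $v$ of degree $k_v$ is $C_v=\frac{2\triangle_v}{k_v(k_v-1)}$, where $\triangle_v$ is the number of triangles containing $v$ (edge weights are ignored). The clustering coefficient $C(\mathcal{G})$ of a graph $\mathcal{G}$ is the average of $C_v$ over all its vertices. The strength of a vertex $i$ in a weighted graph is $s_i=\sum_j w_{ij}$, the sum of the weights of its incident edges. The weighted graphs $\mathcal{W}_n$ ($n\ge 0$) are defined recursively for a fixed integer $\delta\ge1$. $\mathcal{W}_0$ is a triangle whose three edges have weight $1$. For $n\ge1$, $\mathcal{W}_n$ is obtained from $\mathcal{W}_{n-1}$ as follows: (I) for each vertex $i$ of $\mathcal{W}_{n-1}$, of strength $s_i$ in $\mathcal{W}_{n-1}$ (always an even integer), take $s_i/2$ new disjoint copies of $\mathcal{K}_2$ (two vertices joined by an edge of weight $1$) and join both vertices of each copy to $i$ by edges of weight $1$; (II) multiply the weight of every edge that already belonged to $\mathcal{W}_{n-1}$ by $1+\delta$. *)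

theory Defs
  imports Complex_Main
begin

text \<open>Finite simple graphs with natural-number edge weights. An edge is the two-element set of
  its endpoints; the values of \<open>weight\<close> outside \<open>edges\<close> carry no meaning.\<close>

record 'v wgraph =
  verts :: "'v set"
  edges :: "'v set set"
  weight :: "'v set \<Rightarrow> nat"

definition incident :: "'v wgraph \<Rightarrow> 'v \<Rightarrow> 'v set set" where
  "incident G v = {e \<in> edges G. v \<in> e}"

definition strength :: "'v wgraph \<Rightarrow> 'v \<Rightarrow> nat" where
  "strength G v = (\<Sum>e \<in> incident G v. weight G e)"

definition degree :: "'v wgraph \<Rightarrow> 'v \<Rightarrow> nat" where
  "degree G v = card (incident G v)"

definition triangles_at :: "'v wgraph \<Rightarrow> 'v \<Rightarrow> 'v set set" where
  "triangles_at G v =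
     {T. T \<subseteq> verts G \<and> card T = 3 \<and> v \<in> T \<and> (\<forall>x\<in>T. \<forall>y\<in>T. x \<noteq> y \<longrightarrow> {x, y} \<in> edges G)}"

definition local_clustering :: "'v wgraph \<Rightarrow> 'v \<Rightarrow> real" where
  "local_clustering G v =
     2 * real (card (triangles_at G v)) / (real (degree G v) * (real (degree G v) - 1))"

definition clustering :: "'v wgraph \<Rightarrow> real" where
  "clustering G = (\<Sum>v \<in> verts G. local_clustering G v) / real (card (verts G))"

text \<open>\<open>Base 0\<close>, \<open>Base 1\<close>, \<open>Base 2\<close> are the vertices of the initial triangle. \<open>New n i j b\<close> is one of
  the two vertices (selected by \<open>b\<close>) of the \<open>j\<close>-th copy of the complete graph on two vertices
  that is attached to vertex \<open>i\<close> in step \<open>n\<close>; the labels \<open>n\<close>, \<open>i\<close>, \<open>j\<close> make all copies disjoint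
  from each other and from the vertices of earlier steps.\<close>

datatype vertex = Base nat | New nat vertex nat bool

definition initial_triangle :: "vertex wgraph" where
  "initial_triangle =
     \<lparr> verts = {Base 0, Base 1, Base 2},
       edges = {{Base 0, Base 1}, {Base 0, Base 2}, {Base 1, Base 2}},
       weight = (\<lambda>_. 1) \<rparr>"

text \<open>All strengths that arise in the construction are even, so \<open>div 2\<close> below is exact.\<close>

definition copies :: "vertex wgraph \<Rightarrow> (vertex \<times> nat) set" where
  "copies G = {(i, j). i \<in> verts G \<and> j < strength G i div 2}"

definition new_verts :: "nat \<Rightarrow> vertex wgraph \<Rightarrow> vertex set" where
  "new_verts n G = (\<Union>(i, j) \<in> copies G. {New n i j False, New n i j True})"

definition new_edges :: "nat \<Rightarrow> vertex wgraph \<Rightarrow> vertex set set" where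
  "new_edges n G =
     (\<Union>(i, j) \<in> copies G.
        {{New n i j False, New n i j True}, {i, New n i j False}, {i, New n i j True}})"

definition expand :: "nat \<Rightarrow> nat \<Rightarrow> vertex wgraph \<Rightarrow> vertex wgraph" where
  "expand \<delta> n G =
     \<lparr> verts = verts G \<union> new_verts n G,
       edges = edges G \<union> new_edges n G,
       weight = (\<lambda>e. if e \<in> edges G then (1 + \<delta>) * weight G e else 1) \<rparr>"

primrec W :: "nat \<Rightarrow> nat \<Rightarrow> vertex wgraph" where
  "W \<delta> 0 = initial_triangle"
| "W \<delta> (Suc n) = expand \<delta> (Suc n) (W \<delta> n)"

end

theory Submission
  imports Defs
begin

text \<open>A vertex born in step \<open>i\<close> has strength \<open>2 (\<delta> + 2)\<^sup>m\<close> after \<open>m = n - i\<close> further steps, since step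
  (I) adds \<open>s\<close> to its strength \<open>s\<close> and step (II) adds \<open>\<delta> s\<close>. Its degree grows by \<open>s\<close> and its number of
  triangles by \<open>s / 2\<close>, so it always lies on exactly half as many triangles as edges and its
  clustering coefficient is \<open>1 / (k - 1)\<close>. The sum of all strengths is multiplied by \<open>\<delta> + 4\<close>, and it
  equals the number of vertices born in the next step.\<close>

text \<open>In \<open>W \<delta> n\<close>, strength, degree and clustering of a vertex depend only
  on the step that created it.\<close>

primrec birth :: "vertex \<Rightarrow> nat" where
  "birth (Base k) = 0"
| "birth (New n i j b) = n"

text \<open>The triangle that the \<open>j\<close>-th copy attached in step \<open>N\<close> forms
  with its attachment vertex \<open>i\<close>.\<close>

definition petal :: "nat \<Rightarrow> vertex \<Rightarrow> nat \<Rightarrow> vertex set" where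
  "petal N i j = {i, New N i j False, New N i j True}"

text \<open>Referring to no vertex, this set lets the effect of a step be determined once for the
  whole graph and then restricted to old and to new vertices.\<close>

definition triangles :: "'v wgraph \<Rightarrow> 'v set set" where
  "triangles G = {T. T \<subseteq> verts G \<and> card T = 3 \<and> (\<forall>x\<in>T. \<forall>y\<in>T. x \<noteq> y \<longrightarrow> {x, y} \<in> edges G)}"

lemma triangles_at_eq: "triangles_at G v = {T \<in> triangles G. v \<in> T}"
  by (auto simp: triangles_at_def triangles_def)

lemma copies_iff: "(i, j) \<in> copies G \<longleftrightarrow> i \<in> verts G \<and> j < strength G i div 2"
  by (simp add: copies_def)

text \<open>Isolates a single step: \<open>fresh\<close> says that the labels of step
  \<open>N\<close> do not clash with existing vertices. Even strengths are not part of the locale,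
  which explains the terms \<open>2 * (strength G v div 2)\<close> below.\<close>

locale fresh_wgraph =
  fixes N :: nat and G :: "vertex wgraph"
  assumes finite_verts: "finite (verts G)"
    and edge_subset: "e \<in> edges G \<Longrightarrow> e \<subseteq> verts G"
    and fresh: "New N i j b \<notin> verts G"
begin

section \<open>One step: finiteness and the number of new vertices\<close>

lemma finite_edges: "finite (edges G)"
  using finite_verts edge_subset by (meson Pow_iff finite_Pow_iff finite_subset subsetI)

lemma finite_incident: "finite (incident G v)"
  using finite_edges by (simp add: incident_def)

lemma finite_triangles: "finite (triangles G)"
  by (rule finite_subset[of _ "Pow (verts G)"]) (auto simp: triangles_def finite_verts)

lemma copies_Sigma: "copies G = Sigma (verts G) (\<lambda>i. {..<strength G i div 2})"
  by (auto simp: copies_def)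

text \<open>Every new edge has a new endpoint. This keeps old and new edges apart, so their
  contributions to degree and strength can be added.\<close>

lemma new_edge_not_subset: "e \<in> new_edges N G \<Longrightarrow> \<not> e \<subseteq> verts G"
  using fresh by (auto simp: new_edges_def)

lemma new_verts_iff:
  "v \<in> new_verts N G \<longleftrightarrow> (\<exists>i j b. (i, j) \<in> copies G \<and> v = New N i j b)"
proof
  show "\<exists>i j b. (i, j) \<in> copies G \<and> v = New N i j b" if "v \<in> new_verts N G"
    using that by (auto simp: new_verts_def)
next
  assume "\<exists>i j b. (i, j) \<in> copies G \<and> v = New N i j b"
  then obtain i j b where "(i, j) \<in> copies G" "v = New N i j b" by blast
  then show "v \<in> new_verts N G" by (cases b) (auto simp: new_verts_def)
qed

lemma card_new_verts: "card (new_verts N G) = (\<Sum>v\<in>verts G. 2 * (strength G v div 2))"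
proof -
  have eq: "new_verts N G = (\<lambda>((i, j), b). New N i j b) ` (copies G \<times> UNIV)"
    by (force simp: new_verts_iff image_iff)
  have inj: "inj_on (\<lambda>((i, j), b). New N i j b) (copies G \<times> UNIV)"
    by (auto simp: inj_on_def)
  have "card (new_verts N G) = 2 * card (copies G)"
    unfolding eq card_image[OF inj] by (simp add: card_cartesian_product)
  also have "card (copies G) = (\<Sum>v\<in>verts G. strength G v div 2)"
    by (simp add: copies_Sigma card_SigmaI finite_verts)
  finally show ?thesis by (simp add: sum_distrib_left)
qed

lemma finite_new_verts: "finite (new_verts N G)"
  unfolding new_verts_def copies_Sigma using finite_verts by auto

lemma disjoint_new_verts: "verts G \<inter> new_verts N G = {}"
  using fresh by (auto simp: new_verts_iff)

section \<open>One step: incident edges, degrees and strengths\<close>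

lemma incident_new_edges_old:
  assumes "v \<in> verts G"
  shows "{e \<in> new_edges N G. v \<in> e}
           = (\<lambda>(j, b). {v, New N v j b}) ` ({..<strength G v div 2} \<times> UNIV)" (is "?L = ?R")
proof (intro equalityI subsetI)
  fix e assume "e \<in> ?L"
  then obtain i j where ij: "(i, j) \<in> copies G" "v \<in> e"
      "e = {New N i j False, New N i j True} \<or> e = {i, New N i j False} \<or> e = {i, New N i j True}"
    by (auto simp: new_edges_def)
  \<comment> \<open>An old vertex can lie on a new edge only as the vertex to which the copy is
    attached.\<close>
  with assms fresh have "i = v" by auto
  with ij assms fresh have "j < strength G v div 2" "\<exists>b. e = {v, New N v j b}"
    by (auto simp: copies_iff)
  then show "e \<in> ?R" by (auto simp: image_iff)
next
  fix e assume "e \<in> ?R"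
  then obtain j b where "j < strength G v div 2" "e = {v, New N v j b}" by auto
  then have "(v, j) \<in> copies G" "e \<in> {{New N v j False, New N v j True}, {v, New N v j False}, {v, New N v j True}}"
    using assms by (cases b; simp add: copies_iff)+
  then show "e \<in> ?L" using \<open>e = _\<close> unfolding new_edges_def by blast
qed

lemma card_incident_new_edges_old:
  assumes "v \<in> verts G"
  shows "card {e \<in> new_edges N G. v \<in> e} = 2 * (strength G v div 2)"
proof -
  have "inj_on (\<lambda>(j, b). {v, New N v j b}) ({..<strength G v div 2} \<times> UNIV)"
    using assms fresh by (auto simp: inj_on_def doubleton_eq_iff)
  then show ?thesis
    by (simp add: incident_new_edges_old[OF assms] card_image card_cartesian_product)
qed

lemma finite_incident_new_edges_old:
  "v \<in> verts G \<Longrightarrow> finite {e \<in> new_edges N G. v \<in> e}"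
  by (simp add: incident_new_edges_old)

lemma incident_expand: "incident (expand \<delta> N G) v = incident G v \<union> {e \<in> new_edges N G. v \<in> e}"
  by (auto simp: incident_def expand_def)

lemma incident_disjoint: "incident G v \<inter> {e \<in> new_edges N G. v \<in> e} = {}"
  using new_edge_not_subset edge_subset by (auto simp: incident_def)

lemma degree_expand_old:
  assumes "v \<in> verts G"
  shows "degree (expand \<delta> N G) v = degree G v + 2 * (strength G v div 2)"
  unfolding degree_def incident_expand
  by (simp add: card_Un_disjoint finite_incident finite_incident_new_edges_old assms
      incident_disjoint card_incident_new_edges_old)

lemma weight_expand_new: "e \<in> new_edges N G \<Longrightarrow> weight (expand \<delta> N G) e = 1"
  using new_edge_not_subset edge_subset by (auto simp: expand_def)

text \<open>Old incident edges are rescaled, while new ones have weight 1 and contribute their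
  number. For even strength the total is \<open>(\<delta> + 2) * strength G v\<close>.\<close>

lemma strength_expand_old:
  assumes "v \<in> verts G"
  shows "strength (expand \<delta> N G) v = (1 + \<delta>) * strength G v + 2 * (strength G v div 2)"
proof -
  have "strength (expand \<delta> N G) v = (\<Sum>e\<in>incident G v. weight (expand \<delta> N G) e)
          + (\<Sum>e\<in>{e \<in> new_edges N G. v \<in> e}. weight (expand \<delta> N G) e)"
    unfolding strength_def incident_expand
    by (rule sum.union_disjoint)
      (use assms in \<open>simp_all add: finite_incident finite_incident_new_edges_old incident_disjoint\<close>)
  also have "(\<Sum>e\<in>incident G v. weight (expand \<delta> N G) e) = (1 + \<delta>) * strength G v"
    unfolding strength_def sum_distrib_left
    by (rule sum.cong) (auto simp: expand_def incident_def)
  also have "(\<Sum>e\<in>{e \<in> new_edges N G. v \<in> e}. weight (expand \<delta> N G) e)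
               = card {e \<in> new_edges N G. v \<in> e}"
    by (simp add: weight_expand_new)
  finally show ?thesis using card_incident_new_edges_old[OF assms] by simp
qed

text \<open>No old edge reaches a fresh vertex, and the labels \<open>i\<close> and \<open>j\<close>
  determine the copy, so only edges of the vertex's own petal remain.\<close>

lemma incident_expand_new:
  assumes "(i, j) \<in> copies G"
  shows "incident (expand \<delta> N G) (New N i j b)
           = {{New N i j False, New N i j True}, {i, New N i j b}}" (is "_ = ?R")
proof -
  have "New N i j b \<notin> e" if "e \<in> edges G" for e
    using that edge_subset fresh by blast
  moreover have "{e \<in> new_edges N G. New N i j b \<in> e} = ?R"
  proof (intro equalityI subsetI)
    fix e assume "e \<in> {e \<in> new_edges N G. New N i j b \<in> e}"
    then obtain i' j' where "(i', j') \<in> copies G" "New N i j b \<in> e"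
      "e = {New N i' j' False, New N i' j' True} \<or> e = {i', New N i' j' False} \<or> e = {i', New N i' j' True}"
      by (auto simp: new_edges_def)
    \<comment> \<open>The attachment vertex \<open>i'\<close> is old, so the given vertex belongs to
      the copy itself and its labels force \<open>i' = i\<close> and \<open>j' = j\<close>.\<close>
    moreover from this have "i' \<noteq> New N i j b" using fresh by (auto simp: copies_iff)
    ultimately show "e \<in> ?R" by auto
  next
    fix e assume "e \<in> ?R"
    moreover have "{i, New N i j b} \<in> {{New N i j False, New N i j True}, {i, New N i j False}, {i, New N i j True}}"
      by (cases b) auto
    ultimately show "e \<in> {e \<in> new_edges N G. New N i j b \<in> e}"
      using assms unfolding new_edges_def by (cases b) blast+
  qed
  ultimately show ?thesis unfolding incident_expand by (auto simp: incident_def)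
qed

text \<open>Equality would make the old vertex \<open>i\<close> a new one. Distinctness turns the
  two listed edges into degree 2.\<close>

lemma petal_edges_distinct:
  assumes "(i, j) \<in> copies G"
  shows "{New N i j False, New N i j True} \<noteq> {i, New N i j b}"
  using assms fresh by (auto simp: copies_iff doubleton_eq_iff)

lemma degree_expand_new:
  assumes "(i, j) \<in> copies G"
  shows "degree (expand \<delta> N G) (New N i j b) = 2"
  unfolding degree_def incident_expand_new[OF assms] using petal_edges_distinct[OF assms] by simp

lemma strength_expand_new:
  assumes "(i, j) \<in> copies G"
  shows "strength (expand \<delta> N G) (New N i j b) = 2"
proof -
  have "weight (expand \<delta> N G) e = 1" if "e \<in> incident (expand \<delta> N G) (New N i j b)" for e
  proof (rule weight_expand_new)
    have "New N i j b \<in> e" "e \<in> edges G \<or> e \<in> new_edges N G"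
      using that by (auto simp: incident_def expand_def)
    then show "e \<in> new_edges N G" using edge_subset fresh by blast
  qed
  then show ?thesis
    using degree_expand_new[OF assms] by (simp add: strength_def degree_def)
qed

section \<open>One step: triangles\<close>

lemma card_petal: "i \<in> verts G \<Longrightarrow> card (petal N i j) = 3"
  using fresh by (auto simp: petal_def card_insert_if)

lemma petal_Int_verts: "i \<in> verts G \<Longrightarrow> petal N i j \<inter> verts G = {i}"
  using fresh by (auto simp: petal_def)

text \<open>A triangle on old vertices uses old edges only. A triangle with a new vertex is confined
  to that vertex and its two neighbours, hence is the petal.\<close>

lemma triangles_expand:
  "triangles (expand \<delta> N G) = triangles G \<union> (\<lambda>(i, j). petal N i j) ` copies G" (is "?L = ?R")
proof (intro equalityI subsetI)
  fix T assume T: "T \<in> ?L"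
  show "T \<in> ?R"
  proof (cases "T \<subseteq> verts G")
    case True
    have "{x, y} \<in> edges G" if "x \<in> T" "y \<in> T" "x \<noteq> y" for x y
    proof -
      have "{x, y} \<in> edges G \<or> {x, y} \<in> new_edges N G"
        using T that by (auto simp: triangles_def expand_def)
      then show ?thesis using new_edge_not_subset[of "{x, y}"] that True by auto
    qed
    with T True show ?thesis by (auto simp: triangles_def)
  next
    case False
    then obtain u where "u \<in> T" "u \<in> new_verts N G"
      using T by (auto simp: triangles_def expand_def)
    then obtain i j b where ij: "(i, j) \<in> copies G" and u: "New N i j b \<in> T"
      by (auto simp: new_verts_iff)
    have "y \<in> petal N i j" if "y \<in> T" for y
    proof (cases "y = New N i j b")
      case True
      then show ?thesis by (cases b) (auto simp: petal_def)
    next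
      case False
      with T u that have "{New N i j b, y} \<in> incident (expand \<delta> N G) (New N i j b)"
        by (auto simp: triangles_def incident_def)
      then have "{New N i j b, y} = {New N i j False, New N i j True} \<or> {New N i j b, y} = {i, New N i j b}"
        unfolding incident_expand_new[OF ij] by simp
      then show ?thesis using False by (cases b) (auto simp: petal_def doubleton_eq_iff)
    qed
    then have "T \<subseteq> petal N i j" by blast
    moreover have "card T = 3" "card (petal N i j) = 3"
      using T ij card_petal by (auto simp: triangles_def copies_iff)
    \<comment> \<open>The petal is finite because the cardinality of an infinite set is 0 by
      convention; a subset of the same size is then everything.\<close>
    ultimately have "T = petal N i j"
      by (metis card.infinite card_subset_eq zero_neq_numeral)
    with ij show ?thesis by auto
  qed
next
  fix T assume "T \<in> ?R"
  then consider "T \<in> triangles G" | i j where "(i, j) \<in> copies G" "T = petal N i j" by auto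
  then show "T \<in> ?L"
  proof cases
    case 1
    then show ?thesis by (auto simp: triangles_def expand_def)
  next
    case (2 i j)
    have "petal N i j \<subseteq> verts (expand \<delta> N G)"
      using 2(1) by (auto simp: petal_def expand_def new_verts_iff copies_iff)
    moreover have "{x, y} \<in> new_edges N G" if "x \<in> T" "y \<in> T" "x \<noteq> y" for x y
    proof -
      have "{x, y} \<in> {{New N i j False, New N i j True}, {i, New N i j False}, {i, New N i j True}}"
        using that 2 by (auto simp: petal_def)
      then show ?thesis using 2 unfolding new_edges_def by blast
    qed
    ultimately show ?thesis
      using 2 card_petal by (auto simp: triangles_def expand_def copies_iff)
  qed
qed

text \<open>A petal meets the old vertices only in its attachment vertex, so \<open>v\<close> gains
  exactly one triangle per copy attached to it.\<close>

lemma card_triangles_at_expand_old: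
  assumes "v \<in> verts G"
  shows "card (triangles_at (expand \<delta> N G) v) = card (triangles_at G v) + strength G v div 2"
proof -
  have "triangles_at (expand \<delta> N G) v = triangles_at G v \<union> petal N v ` {..<strength G v div 2}"
  proof -
    have "v \<in> petal N i j \<longleftrightarrow> i = v" if "(i, j) \<in> copies G" for i j
      using petal_Int_verts[of i j] that assms by (auto simp: copies_iff)
    then have "{T \<in> (\<lambda>(i, j). petal N i j) ` copies G. v \<in> T} = petal N v ` {..<strength G v div 2}"
      using assms by (force simp: copies_iff image_iff)
    then show ?thesis
      unfolding triangles_at_eq triangles_expand
      by (simp only: Un_iff conj_disj_distribR Collect_disj_eq)
  qed
  moreover have "triangles_at G v \<inter> petal N v ` {..<strength G v div 2} = {}"
    using fresh by (auto simp: triangles_at_def petal_def)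
  moreover have "inj_on (petal N v) {..<strength G v div 2}"
  proof (rule inj_onI)
    fix j k assume "petal N v j = petal N v k"
    \<comment> \<open>This element carries the label \<open>j\<close>, which can therefore be
      recovered from the petal.\<close>
    moreover have "New N v j True \<in> petal N v j" by (simp add: petal_def)
    ultimately have "New N v j True \<in> petal N v k" by simp
    then show "j = k" using assms fresh by (auto simp: petal_def)
  qed
  moreover have "finite (triangles_at G v)"
    by (simp add: triangles_at_eq finite_triangles)
  ultimately show ?thesis by (simp add: card_Un_disjoint card_image)
qed

lemma triangles_at_expand_new:
  assumes "(i, j) \<in> copies G"
  shows "triangles_at (expand \<delta> N G) (New N i j b) = {petal N i j}"
proof -
  have "New N i j b \<notin> T" if "T \<in> triangles G" for T
    using that fresh by (auto simp: triangles_def)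
  moreover have "New N i j b \<in> petal N i' j' \<longleftrightarrow> i' = i \<and> j' = j" if "(i', j') \<in> copies G" for i' j'
    using that fresh by (cases b) (auto simp: petal_def copies_iff)
  ultimately show ?thesis
    using assms unfolding triangles_at_eq triangles_expand by auto
qed

end

section \<open>Invariants of the vertices of \<open>W\<close>\<close>

lemma birth_le:
  "v \<in> verts (W \<delta> n) \<Longrightarrow> birth v \<le> n"
proof (induction n)
  case 0
  then show ?case by (auto simp: initial_triangle_def)
next
  case (Suc n)
  then show ?case by (auto simp: expand_def new_verts_def)
qed

text \<open>\<open>Suc n\<close> is the label used when \<open>W \<delta> n\<close> is expanded; it
  is fresh because all births so far are at most \<open>n\<close>.\<close>

lemma fresh_wgraph_W: "fresh_wgraph (Suc n) (W \<delta> n)"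
proof (induction n)
  case 0
  show ?case by unfold_locales (auto simp: initial_triangle_def)
next
  case (Suc n)
  then interpret fresh_wgraph "Suc n" "W \<delta> n" .
  show ?case
  proof
    show "finite (verts (W \<delta> (Suc n)))"
      by (simp add: expand_def finite_verts finite_new_verts)
    show "e \<subseteq> verts (W \<delta> (Suc n))" if "e \<in> edges (W \<delta> (Suc n))" for e
    proof (cases "e \<in> edges (W \<delta> n)")
      case True
      then show ?thesis using edge_subset by (auto simp: expand_def)
    next
      case False
      with that obtain i j where "(i, j) \<in> copies (W \<delta> n)"
        "e \<subseteq> {i, New (Suc n) i j False, New (Suc n) i j True}"
        by (auto simp: expand_def new_edges_def)
      moreover from this have "New (Suc n) i j b \<in> verts (W \<delta> (Suc n))" for b
        by (auto simp: expand_def new_verts_iff)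
      moreover have "i \<in> verts (W \<delta> (Suc n))"
        using \<open>(i, j) \<in> _\<close> by (simp add: expand_def copies_iff)
      ultimately show ?thesis by blast
    qed
    show "New (Suc (Suc n)) i j b \<notin> verts (W \<delta> (Suc n))" for i j b
      using birth_le by fastforce
  qed
qed

lemma W_0_vertex:
  assumes "v \<in> verts initial_triangle"
  shows "strength initial_triangle v = 2" "degree initial_triangle v = 2"
    "card (triangles_at initial_triangle v) = 1"
proof -
  from assms have v: "v = Base 0 \<or> v = Base 1 \<or> v = Base 2"
    by (simp add: initial_triangle_def)
  \<comment> \<open>Yields degree 2, and also strength 2 since all initial weights are 1.\<close>
  have "\<exists>e f. e \<noteq> f \<and> incident initial_triangle v = {e, f}"
  proof -
    have "incident initial_triangle (Base 0) = {{Base 0, Base 1}, {Base 0, Base 2}}"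
      "incident initial_triangle (Base 1) = {{Base 0, Base 1}, {Base 1, Base 2}}"
      "incident initial_triangle (Base 2) = {{Base 0, Base 2}, {Base 1, Base 2}}"
      by (auto simp: incident_def initial_triangle_def)
    moreover have "{Base 0, Base 1} \<noteq> {Base 0, Base 2}" "{Base 0, Base 1} \<noteq> {Base 1, Base 2}"
      "{Base 0, Base 2} \<noteq> {Base 1, Base 2}"
      by (auto simp: doubleton_eq_iff)
    ultimately show ?thesis using v by metis
  qed
  then show deg: "degree initial_triangle v = 2" by (metis card_2_iff degree_def)
  then show "strength initial_triangle v = 2"
    by (simp add: strength_def degree_def initial_triangle_def)
  have card: "card (verts initial_triangle) = 3" by (simp add: initial_triangle_def)
  have "triangles_at initial_triangle v = {verts initial_triangle}"
  proof (intro equalityI subsetI)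
    fix T assume "T \<in> triangles_at initial_triangle v"
    then have "T \<subseteq> verts initial_triangle" "card T = 3" by (auto simp: triangles_at_def)
    then show "T \<in> {verts initial_triangle}"
      using card card_subset_eq[of "verts initial_triangle" T] by (simp add: initial_triangle_def)
  next
    fix T assume "T \<in> {verts initial_triangle}"
    moreover have "{x, y} \<in> edges initial_triangle"
      if "x \<in> verts initial_triangle" "y \<in> verts initial_triangle" "x \<noteq> y" for x y
      using that by (auto simp: initial_triangle_def insert_commute)
    ultimately show "T \<in> triangles_at initial_triangle v"
      using assms card by (simp add: triangles_at_def)
  qed
  then show "card (triangles_at initial_triangle v) = 1" by simp
qed

lemma verts_W_SucE:
  assumes "v \<in> verts (W \<delta> (Suc n))"
  obtains (old) "v \<in> verts (W \<delta> n)"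
  | (new) i j b where "v = New (Suc n) i j b" "(i, j) \<in> copies (W \<delta> n)"
proof -
  interpret fresh_wgraph "Suc n" "W \<delta> n" by (rule fresh_wgraph_W)
  show ?thesis using assms that by (auto simp: expand_def new_verts_iff)
qed

text \<open>The explicit factor 2 supplies the evenness that makes \<open>div 2\<close> exact, both
  inside this induction and later.\<close>

lemma strength_W:
  "v \<in> verts (W \<delta> n) \<Longrightarrow> strength (W \<delta> n) v = 2 * (\<delta> + 2) ^ (n - birth v)"
proof (induction n)
  case 0
  then show ?case by (simp add: W_0_vertex)
next
  case (Suc n)
  interpret fresh_wgraph "Suc n" "W \<delta> n" by (rule fresh_wgraph_W)
  from Suc.prems show ?case
  proof (cases rule: verts_W_SucE)
    case old
    then show ?thesis
      using Suc.IH birth_le[OF old] by (simp add: strength_expand_old Suc_diff_le algebra_simps)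
  next
    case (new i j b)
    then show ?thesis by (simp add: strength_expand_new)
  qed
qed

text \<open>The degree is 2 plus the geometric sum of the strengths at all earlier steps since
  birth. Multiplying by \<open>\<delta> + 1\<close> clears the denominator and keeps the identity in
  the natural numbers.\<close>

lemma degree_W:
  "v \<in> verts (W \<delta> n) \<Longrightarrow> (\<delta> + 1) * degree (W \<delta> n) v = 2 * ((\<delta> + 2) ^ (n - birth v) + \<delta>)"
proof (induction n)
  case 0
  then show ?case by (simp add: W_0_vertex)
next
  case (Suc n)
  interpret fresh_wgraph "Suc n" "W \<delta> n" by (rule fresh_wgraph_W)
  from Suc.prems show ?case
  proof (cases rule: verts_W_SucE)
    case old
    then show ?thesis
      using Suc.IH[OF old] birth_le[OF old]
      by (simp add: degree_expand_old strength_W Suc_diff_le algebra_simps)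
  next
    case (new i j b)
    then show ?thesis by (simp add: degree_expand_new)
  qed
qed

text \<open>At birth there is one triangle and degree 2; every copy attached later brings one
  triangle and two edges.\<close>

lemma card_triangles_at_W:
  "v \<in> verts (W \<delta> n) \<Longrightarrow> 2 * card (triangles_at (W \<delta> n) v) = degree (W \<delta> n) v"
proof (induction n)
  case 0
  then show ?case by (simp add: W_0_vertex)
next
  case (Suc n)
  interpret fresh_wgraph "Suc n" "W \<delta> n" by (rule fresh_wgraph_W)
  from Suc.prems show ?case
  proof (cases rule: verts_W_SucE)
    case old
    then show ?thesis
      using Suc.IH[OF old] by (simp add: degree_expand_old card_triangles_at_expand_old)
  next
    case (new i j b)
    then show ?thesis by (simp add: degree_expand_new triangles_at_expand_new)
  qed
qed

lemma local_clustering_W: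
  assumes "v \<in> verts (W \<delta> n)"
  shows "local_clustering (W \<delta> n) v
           = (real \<delta> + 1) / (2 * (real \<delta> + 2) ^ (n - birth v) + real \<delta> - 1)"
proof -
  define k where "k = real (degree (W \<delta> n) v)"
  have k: "(real \<delta> + 1) * k = 2 * ((real \<delta> + 2) ^ (n - birth v) + real \<delta>)"
    using arg_cong[OF degree_W[OF assms], of real] by (simp add: k_def algebra_simps)
  \<comment> \<open>Allows \<open>k\<close> to be cancelled in
    \<open>k / (k * (k - 1))\<close>.\<close>
  have "k \<noteq> 0"
  proof
    assume "k = 0"
    with k have "(real \<delta> + 2) ^ (n - birth v) + real \<delta> = 0" by simp
    moreover have "(real \<delta> + 2) ^ (n - birth v) > 0" by simp
    ultimately show False by linarith
  qed
  have "2 * real (card (triangles_at (W \<delta> n) v)) = k"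
    using card_triangles_at_W[OF assms] unfolding k_def by linarith
  then have "local_clustering (W \<delta> n) v = 1 / (k - 1)"
    using \<open>k \<noteq> 0\<close> by (simp add: local_clustering_def flip: k_def)
  \<comment> \<open>Expanding by \<open>\<delta> + 1\<close> makes \<open>degree_W\<close>
    applicable to the denominator.\<close>
  also have "\<dots> = (real \<delta> + 1) / ((real \<delta> + 1) * (k - 1))"
    by simp
  also have "(real \<delta> + 1) * (k - 1) = 2 * (real \<delta> + 2) ^ (n - birth v) + real \<delta> - 1"
    using k by (simp add: algebra_simps)
  finally show ?thesis .
qed

section \<open>Sums over all vertices and the final formula\<close>

lemma card_new_verts_W: "card (new_verts (Suc n) (W \<delta> n)) = (\<Sum>v\<in>verts (W \<delta> n). strength (W \<delta> n) v)"
proof -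
  interpret fresh_wgraph "Suc n" "W \<delta> n" by (rule fresh_wgraph_W)
  show ?thesis by (simp add: card_new_verts strength_W)
qed

lemma sum_verts_W_Suc:
  fixes f :: "vertex \<Rightarrow> 'a :: comm_monoid_add"
  shows "(\<Sum>v\<in>verts (W \<delta> (Suc n)). f v)
           = (\<Sum>v\<in>verts (W \<delta> n). f v) + (\<Sum>v\<in>new_verts (Suc n) (W \<delta> n). f v)"
proof -
  interpret fresh_wgraph "Suc n" "W \<delta> n" by (rule fresh_wgraph_W)
  show ?thesis
    by (simp add: expand_def sum.union_disjoint finite_verts finite_new_verts disjoint_new_verts)
qed

text \<open>Old vertices contribute \<open>\<delta> + 2\<close> times the previous total. The new
  vertices are as many as that total and have strength 2 each, which adds 2 to the factor.\<close>

lemma sum_strength_W: "(\<Sum>v\<in>verts (W \<delta> n). strength (W \<delta> n) v) = 6 * (\<delta> + 4) ^ n"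
proof (induction n)
  case 0
  have "(\<Sum>v\<in>verts initial_triangle. strength initial_triangle v) = (\<Sum>v\<in>verts initial_triangle. 2)"
    by (rule sum.cong) (simp_all add: W_0_vertex)
  also have "\<dots> = 6" by (simp add: initial_triangle_def)
  finally show ?case by simp
next
  case (Suc n)
  interpret fresh_wgraph "Suc n" "W \<delta> n" by (rule fresh_wgraph_W)
  have "(\<Sum>v\<in>verts (W \<delta> n). strength (W \<delta> (Suc n)) v) = (\<Sum>v\<in>verts (W \<delta> n). (\<delta> + 2) * strength (W \<delta> n) v)"
    by (rule sum.cong) (simp_all add: strength_expand_old strength_W)
  moreover have "(\<Sum>v\<in>new_verts (Suc n) (W \<delta> n). strength (W \<delta> (Suc n)) v)
                   = (\<Sum>v\<in>new_verts (Suc n) (W \<delta> n). 2)"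
    by (rule sum.cong) (auto simp: new_verts_iff strength_expand_new)
  ultimately have "(\<Sum>v\<in>verts (W \<delta> (Suc n)). strength (W \<delta> (Suc n)) v)
      = (\<delta> + 2) * (6 * (\<delta> + 4) ^ n) + 2 * (6 * (\<delta> + 4) ^ n)"
    unfolding sum_verts_W_Suc
    by (simp only: sum_distrib_left[symmetric] Suc.IH sum_constant card_new_verts_W) simp
  then show ?case by (simp add: algebra_simps)
qed

text \<open>The births in step \<open>i\<close> number the total strength one step earlier, hence
  the exponent \<open>i - 1\<close>. An arbitrary \<open>g\<close> serves both the vertex count and
  the clustering sum.\<close>

lemma sum_birth_W:
  fixes g :: "nat \<Rightarrow> real"
  shows "(\<Sum>v\<in>verts (W \<delta> n). g (birth v)) = 3 * g 0 + (\<Sum>i = 1..n. 6 * (real \<delta> + 4) ^ (i - 1) * g i)"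
proof (induction n)
  case 0
  show ?case by (simp add: initial_triangle_def)
next
  case (Suc n)
  have "(\<Sum>v\<in>new_verts (Suc n) (W \<delta> n). g (birth v)) = (\<Sum>v\<in>new_verts (Suc n) (W \<delta> n). g (Suc n))"
    by (rule sum.cong) (auto simp: new_verts_def)
  also have "\<dots> = 6 * (real \<delta> + 4) ^ n * g (Suc n)"
    by (simp add: card_new_verts_W sum_strength_W)
  finally show ?case unfolding sum_verts_W_Suc by (simp add: Suc.IH)
qed

lemma card_verts_W:
  "real (card (verts (W \<delta> n))) = (6 * (real \<delta> + 4) ^ n + 3 * real \<delta> + 3) / (real \<delta> + 3)"
proof -
  have "real (card (verts (W \<delta> n))) = 3 + 6 * (\<Sum>i = 1..n. (real \<delta> + 4) ^ (i - 1))"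
    using sum_birth_W[of "\<lambda>_. 1" \<delta> n] by (simp add: sum_distrib_left)
  also have "(\<Sum>i = 1..n. (real \<delta> + 4) ^ (i - 1)) = (\<Sum>i<n. (real \<delta> + 4) ^ i)"
    by (simp add: sum.atLeast1_atMost_eq)
  \<comment> \<open>The denominator is the ratio \<open>\<delta> + 4\<close> minus 1; it becomes the
    numerator \<open>\<delta> + 3\<close> of the final prefactor.\<close>
  also have "\<dots> = ((real \<delta> + 4) ^ n - 1) / (real \<delta> + 3)"
    by (simp add: geometric_sum)
  finally show ?thesis by (simp add: field_simps)
qed

theorem proposition3p6:
  fixes \<delta> n :: nat
  assumes "\<delta> \<ge> 1"
  shows "clustering (W \<delta> n) =
    (real \<delta> + 3) / (6 * (real \<delta> + 4) ^ n + 3 * real \<delta> + 3) *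
    ((\<Sum>i = 1..n. 6 * (real \<delta> + 4) ^ (i - 1) * (real \<delta> + 1)
                    / (2 * (real \<delta> + 2) ^ (n - i) + real \<delta> - 1))
     + (3 * real \<delta> + 3) / (2 * (real \<delta> + 2) ^ n + real \<delta> - 1))"
proof -
  \<comment> \<open>The common clustering coefficient of all vertices born in step \<open>i\<close>;
    the three initial vertices give the separate summand \<open>3 * ?g 0\<close>.\<close>
  let ?g = "\<lambda>i. (real \<delta> + 1) / (2 * (real \<delta> + 2) ^ (n - i) + real \<delta> - 1)"
  have "(\<Sum>v\<in>verts (W \<delta> n). local_clustering (W \<delta> n) v) = (\<Sum>v\<in>verts (W \<delta> n). ?g (birth v))"
    by (rule sum.cong) (simp_all add: local_clustering_W)
  also have "\<dots> = 3 * ?g 0 + (\<Sum>i = 1..n. 6 * (real \<delta> + 4) ^ (i - 1) * ?g i)"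
    by (rule sum_birth_W)
  also have "3 * ?g 0 = (3 * real \<delta> + 3) / (2 * (real \<delta> + 2) ^ n + real \<delta> - 1)"
    by simp
  finally show ?thesis
    by (simp add: clustering_def card_verts_W mult.commute add.commute)
qed

end
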